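(* Let $S$ be a reduced information semialgebra. The following statements are equivalent. (a) $S$ is bi-ACCP, i.e. both $(S,+)$ and $(S^\bullet,\cdot)$ satisfy the ACCP. (b) $T_n(S)^\bullet$ satisfies the right ACCP for every $n\in\mathbb N=\{1,2,\dots\}$. (c) $T_n(S)^\bullet$ satisfies the left ACCP for every $n\in\mathbb N=\{1,2,\dots\}$.
   Context: All monoids are cancellative but not necessarily commutative. An information semialgebra is a semiring $S$ with $0$ and $1$ (so $(S,+)$ is a commutative monoid with identity $0$, multiplication has identity $1$ and distributes over addition, and $0\cdot x=0$ for all $x$) such that $(S,+)$ is a cancellative commutative monoid whose only invertible element is $0$, and $(S\setminus\{0\},\cdot)$ is a cancellative commutative monoid. Write $S^\bullet=S\setminus\{0\}$. $S$ is reduced if $1$ is the only invertible element of $(S^\bullet,\cdot)$. $T_n(S)$ is the semiring of $n\times n$ upper triangular matrices over $S$. $T_n(S)^\bullet$ is the multiplicative monoid of cancellable elements of $T_n(S)$, i.e. of the upper triangular matrices all of whose diagonal entries are nonzero. A monoid $M$ satisfies the left (resp. right) ACCP if every ascending chain of principal left ideals $Mx$ (resp. principal right ideals $xM$), $x\in M$, eventually stabilizes. For commutative $M$ these coincide and are called the ACCP (for $(S,+)$, principal ideals are the sets $x+S$). *)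

theory Defs
  imports "Jordan_Normal_Form.Matrix"
begin

subsection \<open>Principal ideals and chain conditions in monoids\<close>

definition principal_left_ideal :: "('a, 'b) monoid_scheme \<Rightarrow> 'a \<Rightarrow> 'a set" where
  "principal_left_ideal M x = (\<lambda>a. a \<otimes>\<^bsub>M\<^esub> x) ` carrier M"

definition principal_right_ideal :: "('a, 'b) monoid_scheme \<Rightarrow> 'a \<Rightarrow> 'a set" where
  "principal_right_ideal M x = (\<lambda>a. x \<otimes>\<^bsub>M\<^esub> a) ` carrier M"

definition left_accp :: "('a, 'b) monoid_scheme \<Rightarrow> bool" where
  "left_accp M \<longleftrightarrow>
    (\<forall>x :: nat \<Rightarrow> 'a.
      (\<forall>k. x k \<in> carrier M) \<and>
      (\<forall>k. principal_left_ideal M (x k) \<subseteq> principal_left_ideal M (x (Suc k))) \<longrightarrow>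
      (\<exists>N. \<forall>k\<ge>N. principal_left_ideal M (x k) = principal_left_ideal M (x N)))"

definition right_accp :: "('a, 'b) monoid_scheme \<Rightarrow> bool" where
  "right_accp M \<longleftrightarrow>
    (\<forall>x :: nat \<Rightarrow> 'a.
      (\<forall>k. x k \<in> carrier M) \<and>
      (\<forall>k. principal_right_ideal M (x k) \<subseteq> principal_right_ideal M (x (Suc k))) \<longrightarrow>
      (\<exists>N. \<forall>k\<ge>N. principal_right_ideal M (x k) = principal_right_ideal M (x N)))"

text \<open>For commutative monoids both conditions coincide; the name \<open>accp\<close> is
  used for those only.\<close>

abbreviation (input) accp :: "('a, 'b) monoid_scheme \<Rightarrow> bool" where
  "accp M \<equiv> right_accp M"

lemma (in comm_monoid) left_accp_iff_accp: "left_accp G \<longleftrightarrow> accp G"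
proof -
  have "principal_left_ideal G x = principal_right_ideal G x" if "x \<in> carrier G" for x
    unfolding principal_left_ideal_def principal_right_ideal_def
    by (intro image_cong refl m_comm that)
  then show ?thesis
    unfolding left_accp_def right_accp_def by (simp cong: conj_cong)
qed

definition cancellable_elements :: "('a, 'b) monoid_scheme \<Rightarrow> 'a set" where
  "cancellable_elements M =
    {a \<in> carrier M. \<forall>x\<in>carrier M. \<forall>y\<in>carrier M.
       (a \<otimes>\<^bsub>M\<^esub> x = a \<otimes>\<^bsub>M\<^esub> y \<longrightarrow> x = y) \<and> (x \<otimes>\<^bsub>M\<^esub> a = y \<otimes>\<^bsub>M\<^esub> a \<longrightarrow> x = y)}"

subsection \<open>Information semialgebras\<close>

text \<open>The additive cancellation class used here is \<^class>\<open>cancel_semigroup_add\<close>, because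
  \<^class>\<open>cancel_comm_monoid_add\<close> would add a subtraction operation to the structure.
  The class \<^class>\<open>semiring_no_zero_divisors_cancel\<close> contributes that the nonzero elements
  are closed under multiplication and cancellative; commutativity and \<open>0 \<noteq> 1\<close> come from
  \<^class>\<open>comm_semiring_1\<close>.\<close>

class information_semialgebra =
  comm_semiring_1 + cancel_semigroup_add + semiring_no_zero_divisors_cancel +
  assumes add_eq_0_imp_eq_0: "a + b = 0 \<Longrightarrow> a = 0"

definition additive_monoid :: "'a::information_semialgebra itself \<Rightarrow> 'a monoid" where
  "additive_monoid _ = \<lparr>carrier = UNIV, mult = (+), one = 0\<rparr>"

definition nonzero_monoid :: "'a::information_semialgebra itself \<Rightarrow> 'a monoid" where
  "nonzero_monoid _ = \<lparr>carrier = UNIV - {0}, mult = (*), one = 1\<rparr>"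

definition reduced :: "'a::information_semialgebra itself \<Rightarrow> bool" where
  "reduced S \<longleftrightarrow> Units (nonzero_monoid S) = {1}"

definition bi_accp :: "'a::information_semialgebra itself \<Rightarrow> bool" where
  "bi_accp S \<longleftrightarrow> accp (additive_monoid S) \<and> accp (nonzero_monoid S)"

lemma additive_monoid_comm_monoid: "comm_monoid (additive_monoid S)"
  by unfold_locales (auto simp: additive_monoid_def ac_simps)

lemma nonzero_monoid_comm_monoid: "comm_monoid (nonzero_monoid S)"
  by unfold_locales (auto simp: nonzero_monoid_def ac_simps)

subsection \<open>Upper triangular matrices\<close>

definition upper_triangular_semiring ::
    "'a::information_semialgebra itself \<Rightarrow> nat \<Rightarrow> 'a mat ring" where
  "upper_triangular_semiring S n =
    (ring_mat S n ())\<lparr>carrier := {A \<in> carrier_mat n n. upper_triangular A}\<rparr>"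

definition upper_triangular_monoid ::
    "'a::information_semialgebra itself \<Rightarrow> nat \<Rightarrow> 'a mat monoid" where
  "upper_triangular_monoid S n =
    \<lparr>carrier = cancellable_elements (upper_triangular_semiring S n),
     mult = (*), one = 1\<^sub>m n\<rparr>"

lemma mult_mat_entry:
  fixes A B :: "'a::information_semialgebra mat"
  assumes "A \<in> carrier_mat n n" "B \<in> carrier_mat n n" "i < n" "j < n"
  shows "(A * B) $$ (i,j) = (\<Sum>k<n. A $$ (i,k) * B $$ (k,j))"
  using assms by (auto simp: times_mat_def scalar_prod_def lessThan_atLeast0)

lemma upper_triangular_mult:
  fixes A B :: "'a::information_semialgebra mat"
  assumes A: "A \<in> carrier_mat n n" "upper_triangular A"
    and B: "B \<in> carrier_mat n n" "upper_triangular B"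
  shows "upper_triangular (A * B)"
proof (rule upper_triangularI)
  fix i j assume ij: "j < i" "i < dim_row (A * B)"
  then have i: "i < n" "j < n" using A by auto
  have "A $$ (i,k) * B $$ (k,j) = 0" if "k < n" for k
  proof (cases "k < i")
    case True
    then show ?thesis using A i by (simp add: upper_triangularD)
  next
    case False
    then show ?thesis using B i ij that by (simp add: upper_triangularD)
  qed
  then have "(\<Sum>k<n. A $$ (i,k) * B $$ (k,j)) = 0" by (intro sum.neutral) blast
  then show "(A * B) $$ (i,j) = 0"
    by (simp add: mult_mat_entry[OF A(1) B(1) i])
qed

lemma upper_triangular_semiring_simps:
  "carrier (upper_triangular_semiring S n) = {A \<in> carrier_mat n n. upper_triangular A}"
  "mult (upper_triangular_semiring S n) = (*)"
  "one (upper_triangular_semiring S n) = 1\<^sub>m n"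
  "zero (upper_triangular_semiring S n) = 0\<^sub>m n n"
  "add (upper_triangular_semiring S n) = (+)"
  by (simp_all add: upper_triangular_semiring_def ring_mat_def)

lemma semiring_upper_triangular: "semiring (upper_triangular_semiring S n)"
proof -
  have "upper_triangular (A + B)" if "A \<in> carrier_mat n n" "upper_triangular A"
    "B \<in> carrier_mat n n" "upper_triangular B" for A B :: "'a::information_semialgebra mat"
    using that by (intro upper_triangularI) (auto simp: upper_triangularD)
  moreover have "upper_triangular (1\<^sub>m n :: 'a mat)" "upper_triangular (0\<^sub>m n n :: 'a mat)"
    by (auto intro!: upper_triangularI)
  ultimately show ?thesis
    by unfold_locales
      (auto simp: upper_triangular_semiring_simps upper_triangular_mult
        add_mult_distrib_mat mult_add_distrib_mat
        intro: assoc_mult_mat assoc_add_mat comm_add_mat)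
qed

lemma cancellable_left:
  fixes A B C :: "'a::information_semialgebra mat"
  assumes A: "A \<in> carrier_mat n n" "upper_triangular A" and d: "\<And>i. i < n \<Longrightarrow> A $$ (i,i) \<noteq> 0"
    and B: "B \<in> carrier_mat n n" and C: "C \<in> carrier_mat n n" and eq: "A * B = A * C"
  shows "B = C"
proof -
  have "B $$ (i,j) = C $$ (i,j)" if "i < n" "j < n" for i j
    using that
  proof (induction "n - i" arbitrary: i rule: less_induct)
    case less
    have split: "(A * X) $$ (i,j)
        = A $$ (i,i) * X $$ (i,j) + (\<Sum>k\<in>{..<n}-{i}. A $$ (i,k) * X $$ (k,j))"
      if "X \<in> carrier_mat n n" for X
      using mult_mat_entry[OF A(1) that less.prems] less.prems
      by (simp add: sum.remove[of "{..<n}" i])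
    have "(\<Sum>k\<in>{..<n}-{i}. A $$ (i,k) * B $$ (k,j)) = (\<Sum>k\<in>{..<n}-{i}. A $$ (i,k) * C $$ (k,j))"
    proof (rule sum.cong[OF refl])
      fix k assume k: "k \<in> {..<n} - {i}"
      show "A $$ (i,k) * B $$ (k,j) = A $$ (i,k) * C $$ (k,j)"
      proof (cases "k < i")
        case True
        then show ?thesis using A less.prems by (simp add: upper_triangularD)
      next
        case False
        then have "n - k < n - i" using k less.prems by auto
        then show ?thesis using less.hyps[of k] k less.prems by simp
      qed
    qed
    then have "A $$ (i,i) * B $$ (i,j) = A $$ (i,i) * C $$ (i,j)"
      using split[OF B] split[OF C] eq by auto
    then show ?case using d less.prems by simp
  qed
  then show ?thesis using B C by (intro eq_matI) auto
qed

lemma cancellable_right: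
  fixes A B C :: "'a::information_semialgebra mat"
  assumes A: "A \<in> carrier_mat n n" "upper_triangular A" and d: "\<And>i. i < n \<Longrightarrow> A $$ (i,i) \<noteq> 0"
    and B: "B \<in> carrier_mat n n" and C: "C \<in> carrier_mat n n" and eq: "B * A = C * A"
  shows "B = C"
proof -
  have "B $$ (i,j) = C $$ (i,j)" if "i < n" "j < n" for i j
    using that
  proof (induction j rule: less_induct)
    case (less j)
    have split: "(X * A) $$ (i,j)
        = X $$ (i,j) * A $$ (j,j) + (\<Sum>k\<in>{..<n}-{j}. X $$ (i,k) * A $$ (k,j))"
      if "X \<in> carrier_mat n n" for X
      using mult_mat_entry[OF that A(1) less.prems] less.prems
      by (simp add: sum.remove[of "{..<n}" j])
    have "(\<Sum>k\<in>{..<n}-{j}. B $$ (i,k) * A $$ (k,j)) = (\<Sum>k\<in>{..<n}-{j}. C $$ (i,k) * A $$ (k,j))"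
    proof (rule sum.cong[OF refl])
      fix k assume k: "k \<in> {..<n} - {j}"
      show "B $$ (i,k) * A $$ (k,j) = C $$ (i,k) * A $$ (k,j)"
      proof (cases "k < j")
        case True
        then show ?thesis using less.IH[of k] k less.prems by auto
      next
        case False
        then show ?thesis using A k less.prems by (simp add: upper_triangularD)
      qed
    qed
    then have "B $$ (i,j) * A $$ (j,j) = C $$ (i,j) * A $$ (j,j)"
      using split[OF B] split[OF C] unfolding eq
      by (simp only: add_right_cancel)
    then show ?case using d less.prems by simp
  qed
  then show ?thesis using B C by (intro eq_matI) auto
qed

lemma zero_diagonal_collision:
  fixes A :: "'a::information_semialgebra mat"
  assumes A: "A \<in> carrier_mat n n" "upper_triangular A"
    and i: "i < n" "A $$ (i,i) = 0" and d: "\<And>k. k < i \<Longrightarrow> A $$ (k,k) \<noteq> 0"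
    and m: "m \<le> i"
  shows "\<exists>p q :: nat \<Rightarrow> 'a. p i \<noteq> q i \<and> (\<forall>k. k < m \<or> i < k \<longrightarrow> p k = 0 \<and> q k = 0) \<and>
    (\<forall>j. m \<le> j \<and> j < n \<longrightarrow> (\<Sum>k<n. A $$ (j,k) * p k) = (\<Sum>k<n. A $$ (j,k) * q k))"
  using m
proof (induction "i - m" arbitrary: m)
  case 0
  then have m: "m = i" by simp
  let ?p = "\<lambda>k. if k = i then 1 else 0 :: 'a"
  have "A $$ (j,k) * ?p k = 0" if "i \<le> j" "j < n" for j k
    using that i A by (cases "j = i") (auto simp: upper_triangularD)
  then have "(\<Sum>k<n. A $$ (j,k) * ?p k) = 0" if "i \<le> j" "j < n" for j
    using that by (intro sum.neutral) blast
  then show ?case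
    unfolding m by - (rule exI[of _ ?p], rule exI[of _ "\<lambda>_. 0"], simp)
next
  case (Suc t)
  have "t = i - Suc m" "Suc m \<le> i" using Suc by auto
  from Suc.hyps(1)[OF this] obtain p q :: "nat \<Rightarrow> 'a" where pq: "p i \<noteq> q i"
    "\<And>k. k < Suc m \<or> i < k \<Longrightarrow> p k = 0 \<and> q k = 0"
    "\<And>j. Suc m \<le> j \<Longrightarrow> j < n \<Longrightarrow> (\<Sum>k<n. A $$ (j,k) * p k) = (\<Sum>k<n. A $$ (j,k) * q k)"
    by blast
  define a where "a = A $$ (m,m)"
  have a: "a \<noteq> 0" using d[of m] \<open>Suc m \<le> i\<close> by (simp add: a_def)
  define P where "P = (\<Sum>k<n. A $$ (m,k) * p k)"
  define Q where "Q = (\<Sum>k<n. A $$ (m,k) * q k)"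
  define p' where "p' k = a * p k + (if k = m then Q else 0)" for k
  define q' where "q' k = a * q k + (if k = m then P else 0)" for k
  have mn: "m < n" using \<open>Suc m \<le> i\<close> i by simp
  have sp: "(\<Sum>k<n. A $$ (j,k) * p' k) = a * (\<Sum>k<n. A $$ (j,k) * p k) + A $$ (j,m) * Q" for j
  proof -
    have "A $$ (j,k) * p' k = a * (A $$ (j,k) * p k) + (if k = m then A $$ (j,m) * Q else 0)" for k
      by (simp add: p'_def algebra_simps)
    then show ?thesis using mn by (simp add: sum.distrib sum_distrib_left)
  qed
  have sq: "(\<Sum>k<n. A $$ (j,k) * q' k) = a * (\<Sum>k<n. A $$ (j,k) * q k) + A $$ (j,m) * P" for j
  proof -
    have "A $$ (j,k) * q' k = a * (A $$ (j,k) * q k) + (if k = m then A $$ (j,m) * P else 0)" for k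
      by (simp add: q'_def algebra_simps)
    then show ?thesis using mn by (simp add: sum.distrib sum_distrib_left)
  qed
  show ?case
  proof (rule exI[of _ p'], rule exI[of _ q'], intro conjI allI impI)
    show "p' i \<noteq> q' i" using pq(1) a \<open>Suc m \<le> i\<close> by (simp add: p'_def q'_def)
  next
    fix k assume "k < m \<or> i < k"
    then have "p k = 0 \<and> q k = 0" "k \<noteq> m" using pq(2)[of k] \<open>Suc m \<le> i\<close> by auto
    then show "p' k = 0" "q' k = 0" by (simp_all add: p'_def q'_def)
  next
    fix j assume j: "m \<le> j \<and> j < n"
    show "(\<Sum>k<n. A $$ (j,k) * p' k) = (\<Sum>k<n. A $$ (j,k) * q' k)"
    proof (cases "j = m")
      case True
      then show ?thesis unfolding sp sq
        by (simp add: P_def[symmetric] Q_def[symmetric] a_def[symmetric] add.commute)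
    next
      case False
      then have "A $$ (j,m) = 0" using A j by (simp add: upper_triangularD)
      then show ?thesis unfolding sp sq using pq(3)[of j] False j by simp
    qed
  qed
qed

lemma cancellable_upper_triangular_iff:
  "cancellable_elements (upper_triangular_semiring (S :: 'a::information_semialgebra itself) n) =
    {A \<in> carrier_mat n n. upper_triangular A \<and> (\<forall>i<n. A $$ (i,i) \<noteq> 0)}" (is "?L = ?R")
proof
  show "?R \<subseteq> ?L"
    unfolding cancellable_elements_def upper_triangular_semiring_simps
    using cancellable_left cancellable_right by blast
  show "?L \<subseteq> ?R"
  proof
    fix A assume AL: "A \<in> ?L"
    then have A: "A \<in> carrier_mat n n" "upper_triangular A"
      and canc: "\<And>X Y. \<lbrakk>X \<in> carrier_mat n n; upper_triangular X; Y \<in> carrier_mat n n;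
        upper_triangular Y; A * X = A * Y\<rbrakk> \<Longrightarrow> X = Y"
      unfolding cancellable_elements_def upper_triangular_semiring_simps by auto
    have "\<forall>i<n. A $$ (i,i) \<noteq> 0"
    proof (rule ccontr)
      assume "\<not> (\<forall>i<n. A $$ (i,i) \<noteq> 0)"
      then have ex: "\<exists>i. i < n \<and> A $$ (i,i) = 0" by blast
      define i where "i = (LEAST i. i < n \<and> A $$ (i,i) = 0)"
      have i: "i < n" "A $$ (i,i) = 0" using LeastI_ex[OF ex] by (auto simp: i_def)
      have d: "A $$ (k,k) \<noteq> 0" if "k < i" for k
        using not_less_Least[of k "\<lambda>i. i < n \<and> A $$ (i,i) = 0"] that i by (auto simp: i_def)
      obtain p q :: "nat \<Rightarrow> 'a" where pq: "p i \<noteq> q i"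
        "\<And>k. i < k \<Longrightarrow> p k = 0 \<and> q k = 0"
        "\<And>j. j < n \<Longrightarrow> (\<Sum>k<n. A $$ (j,k) * p k) = (\<Sum>k<n. A $$ (j,k) * q k)"
        using zero_diagonal_collision[OF A i d, of 0] by auto
      define M where "M r = mat n n (\<lambda>(k,j). if j = i then r k else (0::'a))" for r
      have Mc: "M r \<in> carrier_mat n n" for r by (simp add: M_def)
      have ut: "upper_triangular (M p)" "upper_triangular (M q)"
        using pq(2) by (auto intro!: upper_triangularI simp: M_def)
      have "A * M p = A * M q"
      proof (rule eq_matI)
        fix j l assume "j < dim_row (A * M q)" "l < dim_col (A * M q)"
        then have jl: "j < n" "l < n" using A Mc[of q] by auto
        have "(A * M r) $$ (j,l) = (if l = i then \<Sum>k<n. A $$ (j,k) * r k else 0)" for r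
          using mult_mat_entry[OF A(1) Mc jl] jl by (simp add: M_def)
        then show "(A * M p) $$ (j,l) = (A * M q) $$ (j,l)" using pq(3) jl by simp
      qed (use Mc[of p] Mc[of q] in auto)
      then have "M p = M q" using canc Mc ut by blast
      then have "M p $$ (i,i) = M q $$ (i,i)" by simp
      then show False using pq(1) i by (simp add: M_def)
    qed
    then show "A \<in> ?R" using A by simp
  qed
qed

lemma monoid_upper_triangular: "monoid (upper_triangular_monoid S n)"
proof -
  have "(A * B) $$ (i,i) \<noteq> 0"
    if "A \<in> carrier_mat n n" "upper_triangular A" "B \<in> carrier_mat n n" "upper_triangular B"
      "A $$ (i,i) \<noteq> 0" "B $$ (i,i) \<noteq> 0" "i < n" for A B :: "'a::information_semialgebra mat" and i
  proof -
    have "A $$ (i,i) * B $$ (i,i) + (\<Sum>k\<in>{..<n}-{i}. A $$ (i,k) * B $$ (k,i)) \<noteq> 0"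
      using that add_eq_0_imp_eq_0[of "A $$ (i,i) * B $$ (i,i)"] by auto
    then show ?thesis
      using mult_mat_entry[OF that(1,3,7,7)] that(7) by (simp add: sum.remove[of "{..<n}" i])
  qed
  moreover have "upper_triangular (1\<^sub>m n :: 'a mat)" by (auto intro!: upper_triangularI)
  ultimately show ?thesis
    by unfold_locales
      (auto simp: upper_triangular_monoid_def cancellable_upper_triangular_iff
        upper_triangular_mult intro: assoc_mult_mat)
qed

end

theory Submission
  imports Defs
begin

text \<open>
  If \<open>A\<^sub>k = A\<^sub>k\<^sub>+\<^sub>1 B\<^sub>k\<close> in \<open>T\<^sub>n(S)\<close>, then the diagonal entries form multiplicative chains, which
  become constant because \<open>S\<close> is reduced; from then on \<open>B\<^sub>k\<close> has unit diagonal, so that each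
  entry of \<open>A\<^sub>k\<close> is the corresponding entry of \<open>A\<^sub>k\<^sub>+\<^sub>1\<close> plus something, and the additive chain
  condition makes all entries constant. Conversely both \<open>(S,+)\<close> and the nonzero elements of
  \<open>S\<close> embed in \<open>T\<^sub>2(S)\<close>, as unipotent and as diagonal matrices, in a way that reflects
  divisibility. The left-handed versions are the right-handed ones in the opposite monoid.
\<close>

section \<open>Opposite monoids, and chain conditions in terms of divisibility\<close>

definition opposite_monoid :: "('a, 'b) monoid_scheme \<Rightarrow> 'a monoid" where
  "opposite_monoid M = \<lparr>carrier = carrier M, mult = (\<lambda>a b. b \<otimes>\<^bsub>M\<^esub> a), one = \<one>\<^bsub>M\<^esub>\<rparr>"

lemma opposite_monoid_simps [simp]:
  "carrier (opposite_monoid M) = carrier M"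
  "a \<otimes>\<^bsub>opposite_monoid M\<^esub> b = b \<otimes>\<^bsub>M\<^esub> a"
  "\<one>\<^bsub>opposite_monoid M\<^esub> = \<one>\<^bsub>M\<^esub>"
  by (simp_all add: opposite_monoid_def)

lemma (in monoid) monoid_opposite: "monoid (opposite_monoid G)"
  by unfold_locales (auto simp: m_assoc)

lemma left_accp_iff_opposite: "left_accp M \<longleftrightarrow> right_accp (opposite_monoid M)"
  by (simp add: left_accp_def right_accp_def principal_left_ideal_def principal_right_ideal_def)

lemma (in monoid) principal_right_ideal_subset_iff:
  assumes "x \<in> carrier G" "y \<in> carrier G"
  shows "principal_right_ideal G x \<subseteq> principal_right_ideal G y
    \<longleftrightarrow> (\<exists>a\<in>carrier G. x = y \<otimes> a)" (is "?L \<longleftrightarrow> ?R")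
proof
  assume ?L
  moreover have "x \<in> principal_right_ideal G x"
    unfolding principal_right_ideal_def using assms by (intro image_eqI[of _ _ \<one>]) auto
  ultimately show ?R unfolding principal_right_ideal_def by auto
next
  assume ?R
  then show ?L unfolding principal_right_ideal_def using assms by (auto simp: m_assoc)
qed

text \<open>Inclusion of principal right ideals is divisibility, so an ascending chain is a sequence
  in which \<open>x k\<close> is a right multiple of \<open>x (Suc k)\<close>; it is stationary from
  \<open>N\<close> on exactly when \<open>x (Suc k)\<close> is also a right multiple of
  \<open>x k\<close> for all \<open>k\<close> \<ge> \<open>N\<close>. This form speaks of
  neighbouring elements instead of ideals.\<close>

lemma (in monoid) right_accp_iff:
  "right_accp G \<longleftrightarrow>
    (\<forall>x :: nat \<Rightarrow> 'a. (\<forall>k. x k \<in> carrier G) \<longrightarrow> (\<forall>k. \<exists>a\<in>carrier G. x k = x (Suc k) \<otimes> a) \<longrightarrow>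
      (\<forall>\<^sub>F k in sequentially. \<exists>a\<in>carrier G. x (Suc k) = x k \<otimes> a))" (is "_ \<longleftrightarrow> ?R")
proof
  assume acc: "right_accp G"
  show ?R
  proof (intro allI impI)
    fix x :: "nat \<Rightarrow> 'a"
    assume x: "\<forall>k. x k \<in> carrier G" and "\<forall>k. \<exists>a\<in>carrier G. x k = x (Suc k) \<otimes> a"
    then have "\<forall>k. principal_right_ideal G (x k) \<subseteq> principal_right_ideal G (x (Suc k))"
      by (simp add: principal_right_ideal_subset_iff)
    with acc x obtain N where
      N: "\<And>k. k \<ge> N \<Longrightarrow> principal_right_ideal G (x k) = principal_right_ideal G (x N)"
      unfolding right_accp_def by blast
    have "\<exists>a\<in>carrier G. x (Suc k) = x k \<otimes> a" if "k \<ge> N" for k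
      using N[of k] N[of "Suc k"] that x
      by (subst principal_right_ideal_subset_iff[symmetric]) auto
    then show "\<forall>\<^sub>F k in sequentially. \<exists>a\<in>carrier G. x (Suc k) = x k \<otimes> a"
      unfolding eventually_sequentially by blast
  qed
next
  assume R: ?R
  show "right_accp G" unfolding right_accp_def
  proof (intro allI impI, elim conjE)
    fix x :: "nat \<Rightarrow> 'a"
    assume x: "\<forall>k. x k \<in> carrier G"
      and sub: "\<forall>k. principal_right_ideal G (x k) \<subseteq> principal_right_ideal G (x (Suc k))"
    then have "\<forall>k. \<exists>a\<in>carrier G. x k = x (Suc k) \<otimes> a"
      by (simp add: principal_right_ideal_subset_iff)
    with R x obtain N where N: "\<And>k. k \<ge> N \<Longrightarrow> \<exists>a\<in>carrier G. x (Suc k) = x k \<otimes> a"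
      unfolding eventually_sequentially by blast
    \<comment> \<open>Converse divisibility supplies the missing inclusion between neighbouring
      ideals; induction from \<open>N\<close> upwards then links them all to the ideal of
      \<open>x N\<close>.\<close>
    have step: "principal_right_ideal G (x (Suc k)) = principal_right_ideal G (x k)" if "k \<ge> N" for k
      using N[OF that] sub x principal_right_ideal_subset_iff[of "x (Suc k)" "x k"] by blast
    have "principal_right_ideal G (x k) = principal_right_ideal G (x N)" if "k \<ge> N" for k
      using that by (induction k rule: dec_induct) (simp_all add: step)
    then show "\<exists>N. \<forall>k\<ge>N. principal_right_ideal G (x k) = principal_right_ideal G (x N)"
      by blast
  qed
qed

text \<open>The homomorphism carries a chain of \<open>G\<close> to a chain of \<open>H\<close>, and
  \<open>refl\<close> brings the converse divisibilities found there back to \<open>G\<close>. Its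
  quotient \<open>b\<close> ranges over all of \<open>H\<close>, not only over the image of
  \<open>f\<close>, because the chain condition in \<open>H\<close> gives no control over where
  quotients lie.\<close>

lemma right_accp_reflect:
  assumes "monoid G" "monoid H" "right_accp H" and f: "f \<in> hom G H"
    and refl: "\<And>x y b. \<lbrakk>x \<in> carrier G; y \<in> carrier G; b \<in> carrier H; f x = f y \<otimes>\<^bsub>H\<^esub> b\<rbrakk>
      \<Longrightarrow> \<exists>a\<in>carrier G. x = y \<otimes>\<^bsub>G\<^esub> a"
  shows "right_accp G"
  unfolding monoid.right_accp_iff[OF \<open>monoid G\<close>]
proof (intro allI impI)
  fix x :: "nat \<Rightarrow> 'a"
  assume x: "\<forall>k. x k \<in> carrier G"
    and chain: "\<forall>k. \<exists>a\<in>carrier G. x k = x (Suc k) \<otimes>\<^bsub>G\<^esub> a"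
  have "\<exists>b\<in>carrier H. f (x k) = f (x (Suc k)) \<otimes>\<^bsub>H\<^esub> b" for k
  proof -
    obtain a where "a \<in> carrier G" "x k = x (Suc k) \<otimes>\<^bsub>G\<^esub> a" using chain by blast
    then show ?thesis
      using x by (intro bexI[of _ "f a"]) (simp_all add: hom_mult[OF f] hom_in_carrier[OF f])
  qed
  moreover have "\<forall>k. f (x k) \<in> carrier H" using x hom_in_carrier[OF f] by blast
  ultimately have "\<forall>\<^sub>F k in sequentially. \<exists>b\<in>carrier H. f (x (Suc k)) = f (x k) \<otimes>\<^bsub>H\<^esub> b"
    using \<open>right_accp H\<close>[unfolded monoid.right_accp_iff[OF \<open>monoid H\<close>],
        THEN spec[of _ "\<lambda>k. f (x k)"]] by blast
  then show "\<forall>\<^sub>F k in sequentially. \<exists>a\<in>carrier G. x (Suc k) = x k \<otimes>\<^bsub>G\<^esub> a"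
    by (rule eventually_mono) (use refl x in blast)
qed

section \<open>Chains in the additive and the multiplicative monoid of S\<close>

lemma additive_chain_stabilizes:
  fixes x :: "nat \<Rightarrow> 'a::information_semialgebra"
  assumes acc: "accp (additive_monoid TYPE('a))" and chain: "\<And>k. \<exists>s. x k = x (Suc k) + s"
  shows "\<forall>\<^sub>F k in sequentially. x (Suc k) = x k"
proof -
  interpret comm_monoid "additive_monoid TYPE('a)" by (rule additive_monoid_comm_monoid)
  have "\<forall>\<^sub>F k in sequentially. \<exists>s. x (Suc k) = x k + s"
    using acc chain unfolding right_accp_iff by (simp add: additive_monoid_def)
  then show ?thesis
  proof (rule eventually_mono)
    fix k assume "\<exists>s. x (Suc k) = x k + s"
    then obtain s where s: "x (Suc k) = x k + s" ..
    moreover obtain t where "x k = x (Suc k) + t" using chain by blast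
    \<comment> \<open>Substituting the two relations into each other and cancelling
      \<open>x k\<close> leaves a vanishing sum, so 0 being the only additive unit turns mutual
      divisibility into equality.\<close>
    ultimately have "x k + (s + t) = x k + 0" by (simp add: add.assoc[symmetric])
    then have "s + t = 0" by (rule add_left_imp_eq)
    then have "s = 0" by (rule add_eq_0_imp_eq_0)
    with s show "x (Suc k) = x k" by simp
  qed
qed

lemma reduced_mult_eq_1D:
  fixes a b :: "'a::information_semialgebra"
  assumes "reduced TYPE('a)" "a * b = 1"
  shows "a = 1"
proof -
  have "a \<noteq> 0" "b \<noteq> 0" using assms(2) by auto
  then have "a \<in> Units (nonzero_monoid TYPE('a))"
    using assms(2) by (auto simp: Units_def nonzero_monoid_def mult.commute)
  then show ?thesis using assms(1) by (simp add: reduced_def)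
qed

lemma multiplicative_chain_stabilizes:
  fixes x :: "nat \<Rightarrow> 'a::information_semialgebra"
  assumes red: "reduced TYPE('a)" and acc: "accp (nonzero_monoid TYPE('a))"
    and nz: "\<And>k. x k \<noteq> 0" and chain: "\<And>k. x (Suc k) dvd x k"
  shows "\<forall>\<^sub>F k in sequentially. x (Suc k) = x k"
proof -
  interpret comm_monoid "nonzero_monoid TYPE('a)" by (rule nonzero_monoid_comm_monoid)
  \<comment> \<open>The quotient has to lie in the carrier, which excludes 0; it does because
    \<open>x k\<close> is nonzero.\<close>
  have "\<exists>a. a \<noteq> 0 \<and> x k = x (Suc k) * a" for k
    using chain[of k] nz[of k] by (auto elim!: dvdE)
  then have "\<forall>\<^sub>F k in sequentially. \<exists>a. a \<noteq> 0 \<and> x (Suc k) = x k * a"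
    using acc nz unfolding right_accp_iff by (simp add: nonzero_monoid_def Bex_def)
  then show ?thesis
  proof (rule eventually_mono)
    fix k assume "\<exists>a. a \<noteq> 0 \<and> x (Suc k) = x k * a"
    then obtain a where a: "x (Suc k) = x k * a" by blast
    moreover obtain b where "x k = x (Suc k) * b" using chain by (auto elim: dvdE)
    \<comment> \<open>The explicit factor 1 makes this an instance of cancellation by a nonzero
      element, hence the deletion of \<open>mult_1_right\<close> below.\<close>
    ultimately have "x k * (a * b) = x k * 1" by (simp add: mult.assoc[symmetric])
    then have "a * b = 1" using nz[of k] by (simp del: mult_1_right)
    then have "a = 1" by (rule reduced_mult_eq_1D[OF red])
    with a show "x (Suc k) = x k" by simp
  qed
qed

section \<open>Chains of upper triangular matrices\<close>

lemma upper_triangular_mult_diag: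
  fixes A B :: "'a::information_semialgebra mat"
  assumes "A \<in> carrier_mat n n" "upper_triangular A" "B \<in> carrier_mat n n" "upper_triangular B"
    and i: "i < n"
  shows "(A * B) $$ (i,i) = A $$ (i,i) * B $$ (i,i)"
proof -
  \<comment> \<open>For \<open>k < i\<close> the entry of \<open>A\<close> lies below the diagonal,
    for \<open>k > i\<close> that of \<open>B\<close> does.\<close>
  have "A $$ (i,k) * B $$ (k,i) = 0" if "k \<in> {..<n} - {i}" for k
    using that assms by (cases "k < i") (auto simp: upper_triangularD)
  then have "(\<Sum>k\<in>{..<n}-{i}. A $$ (i,k) * B $$ (k,i)) = 0" by (intro sum.neutral) blast
  then show ?thesis
    using mult_mat_entry[OF assms(1,3) i i] i by (simp add: sum.remove[of "{..<n}" i])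
qed

text \<open>The part of the argument common to left and right factorizations: \<open>diag\<close>
  and \<open>entry\<close> are all it takes from them. In \<open>entry\<close> the additive relation
  is demanded only at indices where the whole diagonal has stopped changing, since only there does
  the quotient have unit diagonal.\<close>

lemma matrix_chain_stabilizes:
  fixes A :: "nat \<Rightarrow> 'a::information_semialgebra mat"
  assumes red: "reduced TYPE('a)" and acc: "bi_accp TYPE('a)"
    and A: "\<And>k. A k \<in> carrier_mat n n" and nz: "\<And>k i. i < n \<Longrightarrow> A k $$ (i,i) \<noteq> 0"
    and diag: "\<And>k i. i < n \<Longrightarrow> A (Suc k) $$ (i,i) dvd A k $$ (i,i)"
    and entry: "\<And>k i j. \<lbrakk>\<And>l. l < n \<Longrightarrow> A (Suc k) $$ (l,l) = A k $$ (l,l); i < n; j < n\<rbrakk>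
      \<Longrightarrow> \<exists>s. A k $$ (i,j) = A (Suc k) $$ (i,j) + s"
  shows "\<forall>\<^sub>F k in sequentially. A (Suc k) = A k"
proof -
  \<comment> \<open>There are finitely many diagonal entries, so a single index serves for all of
    them.\<close>
  have "\<forall>\<^sub>F k in sequentially. \<forall>i\<in>{..<n}. A (Suc k) $$ (i,i) = A k $$ (i,i)"
    using red acc nz diag
    by (intro eventually_ball_finite ballI multiplicative_chain_stabilizes) (auto simp: bi_accp_def)
  then obtain N where N: "\<And>k i. k \<ge> N \<Longrightarrow> i < n \<Longrightarrow> A (Suc k) $$ (i,i) = A k $$ (i,i)"
    unfolding eventually_sequentially by blast
  \<comment> \<open>The additive lemma asks for a chain at every index, but \<open>entry\<close>
    applies only from \<open>N\<close> on; the sequence is therefore shifted by \<open>N\<close>,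
    and the shift is undone at the end.\<close>
  have "\<forall>\<^sub>F k in sequentially. \<forall>p\<in>{..<n}\<times>{..<n}. A (Suc (k + N)) $$ p = A (k + N) $$ p"
  proof (intro eventually_ball_finite ballI)
    fix p assume "p \<in> {..<n}\<times>{..<n}"
    then obtain i j where p: "p = (i,j)" "i < n" "j < n" by auto
    have "\<exists>s. A (k + N) $$ (i,j) = A (Suc k + N) $$ (i,j) + s" for k
      using entry[of "k + N" i j] N p by simp
    from additive_chain_stabilizes[of "\<lambda>k. A (k + N) $$ (i,j)", OF _ this] acc
    show "\<forall>\<^sub>F k in sequentially. A (Suc (k + N)) $$ p = A (k + N) $$ p"
      by (simp add: p bi_accp_def)
  qed simp
  then have "\<forall>\<^sub>F k in sequentially. A (Suc (k + N)) = A (k + N)"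
    by (rule eventually_mono) (use A in \<open>auto intro!: eq_matI simp: carrier_matD[OF A]\<close>)
  then show ?thesis by (simp add: eventually_sequentially_seg[of "\<lambda>k. A (Suc k) = A k"])
qed

lemma upper_triangular_monoid_simps:
  "carrier (upper_triangular_monoid (S :: 'a::information_semialgebra itself) n) =
    {A \<in> carrier_mat n n. upper_triangular A \<and> (\<forall>i<n. A $$ (i,i) \<noteq> 0)}"
  "A \<otimes>\<^bsub>upper_triangular_monoid S n\<^esub> B = A * B"
  "\<one>\<^bsub>upper_triangular_monoid S n\<^esub> = 1\<^sub>m n"
  by (simp_all add: upper_triangular_monoid_def cancellable_upper_triangular_iff)

text \<open>Once the diagonal is constant, \<open>B k\<close> has unit diagonal. In the sum for
  entry \<open>(i,j)\<close> of \<open>A (Suc k) * B k\<close> the term \<open>l = j\<close> is then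
  the entry \<open>(i,j)\<close> of \<open>A (Suc k)\<close> itself, and the remaining terms form
  the summand required by \<open>entry\<close>.\<close>

lemma right_accp_upper_triangular:
  assumes red: "reduced TYPE('a::information_semialgebra)" and acc: "bi_accp TYPE('a)"
  shows "right_accp (upper_triangular_monoid TYPE('a) n)" (is "right_accp ?T")
  unfolding monoid.right_accp_iff[OF monoid_upper_triangular]
proof (intro allI impI)
  interpret T: monoid ?T by (rule monoid_upper_triangular)
  fix A :: "nat \<Rightarrow> 'a mat"
  assume AT: "\<forall>k. A k \<in> carrier ?T" and "\<forall>k. \<exists>B\<in>carrier ?T. A k = A (Suc k) \<otimes>\<^bsub>?T\<^esub> B"
  then obtain B where BT: "\<And>k. B k \<in> carrier ?T" and eq: "\<And>k. A k = A (Suc k) * B k"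
    unfolding upper_triangular_monoid_simps(2) by metis
  have A: "A k \<in> carrier_mat n n" "upper_triangular (A k)" "i < n \<Longrightarrow> A k $$ (i,i) \<noteq> 0" for k i
    using AT by (auto simp: upper_triangular_monoid_simps)
  have B: "B k \<in> carrier_mat n n" "upper_triangular (B k)" for k
    using BT by (auto simp: upper_triangular_monoid_simps)
  have diag: "A k $$ (i,i) = A (Suc k) $$ (i,i) * B k $$ (i,i)" if "i < n" for k i
    unfolding eq[of k] by (rule upper_triangular_mult_diag[OF A(1,2) B that])
  have "\<forall>\<^sub>F k in sequentially. A (Suc k) = A k"
  proof (rule matrix_chain_stabilizes[OF red acc A(1,3)])
    fix k i j assume const: "\<And>l. l < n \<Longrightarrow> A (Suc k) $$ (l,l) = A k $$ (l,l)" and ij: "i < n" "j < n"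
    have "A k $$ (j,j) * B k $$ (j,j) = A k $$ (j,j) * 1"
      using diag[OF ij(2), of k] const[OF ij(2)] by simp
    then have "B k $$ (j,j) = 1" using A(3)[OF ij(2), of k] by (simp del: mult_1_right)
    then have "A k $$ (i,j) = A (Suc k) $$ (i,j)
        + (\<Sum>l\<in>{..<n}-{j}. A (Suc k) $$ (i,l) * B k $$ (l,j))"
      using mult_mat_entry[OF A(1)[of "Suc k"] B(1)[of k] ij] ij
      by (simp add: eq[of k, symmetric] sum.remove[of "{..<n}" j])
    then show "\<exists>s. A k $$ (i,j) = A (Suc k) $$ (i,j) + s" ..
  next
    fix k i assume "i < n"
    then show "A (Suc k) $$ (i,i) dvd A k $$ (i,i)" by (metis diag dvd_triv_left)
  qed
  then show "\<forall>\<^sub>F k in sequentially. \<exists>B\<in>carrier ?T. A (Suc k) = A k \<otimes>\<^bsub>?T\<^esub> B"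
  proof (rule eventually_mono)
    fix k assume "A (Suc k) = A k"
    then show "\<exists>B\<in>carrier ?T. A (Suc k) = A k \<otimes>\<^bsub>?T\<^esub> B"
      using AT by (intro bexI[of _ "\<one>\<^bsub>?T\<^esub>"]) simp_all
  qed
qed

text \<open>With the quotient on the left, the distinguished term is \<open>l = i\<close>: its
  coefficient is \<open>B k $$ (i,i)\<close>, taken from the row of the entry instead of its
  column.\<close>

lemma left_accp_upper_triangular:
  assumes red: "reduced TYPE('a::information_semialgebra)" and acc: "bi_accp TYPE('a)"
  shows "left_accp (upper_triangular_monoid TYPE('a) n)" (is "left_accp ?T")
  unfolding left_accp_iff_opposite
    monoid.right_accp_iff[OF monoid.monoid_opposite[OF monoid_upper_triangular]]
    opposite_monoid_simps
proof (intro allI impI)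
  interpret T: monoid ?T by (rule monoid_upper_triangular)
  fix A :: "nat \<Rightarrow> 'a mat"
  assume AT: "\<forall>k. A k \<in> carrier ?T" and "\<forall>k. \<exists>B\<in>carrier ?T. A k = B \<otimes>\<^bsub>?T\<^esub> A (Suc k)"
  then obtain B where BT: "\<And>k. B k \<in> carrier ?T" and eq: "\<And>k. A k = B k * A (Suc k)"
    unfolding upper_triangular_monoid_simps(2) by metis
  have A: "A k \<in> carrier_mat n n" "upper_triangular (A k)" "i < n \<Longrightarrow> A k $$ (i,i) \<noteq> 0" for k i
    using AT by (auto simp: upper_triangular_monoid_simps)
  have B: "B k \<in> carrier_mat n n" "upper_triangular (B k)" for k
    using BT by (auto simp: upper_triangular_monoid_simps)
  have diag: "A k $$ (i,i) = B k $$ (i,i) * A (Suc k) $$ (i,i)" if "i < n" for k i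
    unfolding eq[of k] by (rule upper_triangular_mult_diag[OF B A(1,2) that])
  have "\<forall>\<^sub>F k in sequentially. A (Suc k) = A k"
  proof (rule matrix_chain_stabilizes[OF red acc A(1,3)])
    fix k i j assume const: "\<And>l. l < n \<Longrightarrow> A (Suc k) $$ (l,l) = A k $$ (l,l)" and ij: "i < n" "j < n"
    have "B k $$ (i,i) * A k $$ (i,i) = 1 * A k $$ (i,i)"
      using diag[OF ij(1), of k] const[OF ij(1)] by simp
    then have "B k $$ (i,i) = 1" using A(3)[OF ij(1), of k] by (simp del: mult_1_left)
    then have "A k $$ (i,j) = A (Suc k) $$ (i,j)
        + (\<Sum>l\<in>{..<n}-{i}. B k $$ (i,l) * A (Suc k) $$ (l,j))"
      using mult_mat_entry[OF B(1)[of k] A(1)[of "Suc k"] ij] ij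
      by (simp add: eq[of k, symmetric] sum.remove[of "{..<n}" i])
    then show "\<exists>s. A k $$ (i,j) = A (Suc k) $$ (i,j) + s" ..
  next
    fix k i assume "i < n"
    then show "A (Suc k) $$ (i,i) dvd A k $$ (i,i)" by (metis diag dvd_triv_right)
  qed
  then show "\<forall>\<^sub>F k in sequentially. \<exists>B\<in>carrier ?T. A (Suc k) = B \<otimes>\<^bsub>?T\<^esub> A k"
  proof (rule eventually_mono)
    fix k assume "A (Suc k) = A k"
    then show "\<exists>B\<in>carrier ?T. A (Suc k) = B \<otimes>\<^bsub>?T\<^esub> A k"
      using AT by (intro bexI[of _ "\<one>\<^bsub>?T\<^esub>"]) simp_all
  qed
qed

section \<open>Embedding both monoids of S into 2 by 2 matrices\<close>

definition affine_mat :: "'a::information_semialgebra \<Rightarrow> 'a \<Rightarrow> 'a mat" where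
  "affine_mat a b =
    mat 2 2 (\<lambda>(i,j). if i = 0 then if j = 0 then a else b else if j = 0 then 0 else 1)"

lemma affine_mat_entries [simp]:
  "affine_mat a b \<in> carrier_mat 2 2"
  "dim_row (affine_mat a b) = 2" "dim_col (affine_mat a b) = 2"
  "affine_mat a b $$ (0,0) = a" "affine_mat a b $$ (0,Suc 0) = b"
  "affine_mat a b $$ (Suc 0,0) = 0" "affine_mat a b $$ (Suc 0,Suc 0) = 1"
  by (simp_all add: affine_mat_def)

lemma mult_mat_entry_2:
  fixes A B :: "'a::information_semialgebra mat"
  assumes "A \<in> carrier_mat 2 2" "B \<in> carrier_mat 2 2" "i < 2" "j < 2"
  shows "(A * B) $$ (i,j) = A $$ (i,0) * B $$ (0,j) + A $$ (i,Suc 0) * B $$ (Suc 0,j)"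
  unfolding mult_mat_entry[OF assms] by (simp add: numeral_2_eq_2)

text \<open>\<open>affine_mat a b\<close> represents the affine map t -> a t + b, and the product is
  composition. The translations \<open>affine_mat 1 b\<close> thus copy addition, the dilations
  \<open>affine_mat a 0\<close> multiplication.\<close>

lemma affine_mat_mult: "affine_mat a b * affine_mat c d = affine_mat (a * c) (a * d + b)"
proof (rule eq_matI)
  fix i j assume "i < dim_row (affine_mat (a * c) (a * d + b))"
    "j < dim_col (affine_mat (a * c) (a * d + b))"
  then have ij: "i < 2" "j < 2"
    by auto
  then show "(affine_mat a b * affine_mat c d) $$ (i,j) = affine_mat (a * c) (a * d + b) $$ (i,j)"
    by (subst mult_mat_entry_2) (auto simp: less_2_cases_iff)
qed auto

lemma affine_mat_closed:
  fixes a b :: "'a::information_semialgebra"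
  assumes "a \<noteq> 0"
  shows "affine_mat a b \<in> carrier (upper_triangular_monoid TYPE('a) 2)"
proof -
  have "affine_mat a b $$ (i,j) = 0" if "j < i" "i < 2" for i j
  proof -
    have "i = Suc 0" "j = 0" using that by linarith+
    then show ?thesis by simp
  qed
  then have "upper_triangular (affine_mat a b)" by (intro upper_triangularI) simp
  moreover have "affine_mat a b $$ (i,i) \<noteq> 0" if "i < 2" for i
    using that assms unfolding less_2_cases_iff by (elim disjE) simp_all
  ultimately show ?thesis unfolding upper_triangular_monoid_simps by simp
qed

text \<open>Translations and dilations are homomorphisms that reflect divisibility: a quotient
  \<open>B\<close> may be any matrix of the monoid, but the entries of the product equation show
  that one of its entries is a quotient in S.\<close>

lemma bi_accp_if_right_accp:
  assumes "right_accp (upper_triangular_monoid TYPE('a::information_semialgebra) 2)"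
    (is "right_accp ?T")
  shows "bi_accp TYPE('a)"
  unfolding bi_accp_def
proof
  note T = monoid_upper_triangular[of "TYPE('a)" 2]
  show "accp (additive_monoid TYPE('a))"
  proof (rule right_accp_reflect[OF _ T assms, where f = "affine_mat 1"])
    show "affine_mat 1 \<in> hom (additive_monoid TYPE('a)) ?T"
      by (auto simp: hom_def affine_mat_closed upper_triangular_monoid_simps(2) affine_mat_mult
          additive_monoid_def add.commute)
  next
    fix x y :: 'a and B assume B: "B \<in> carrier ?T"
      and eq: "affine_mat 1 x = affine_mat 1 y \<otimes>\<^bsub>?T\<^esub> B"
    have Bc: "B \<in> carrier_mat 2 2" using B by (simp add: upper_triangular_monoid_simps)
    \<comment> \<open>Folding with \<open>eq\<close> turns the product into
      \<open>affine_mat 1 x\<close>, so each instance is an equation in S. The lower right one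
      forces \<open>B $$ (Suc 0,Suc 0) = 1\<close>, and the upper right one then exhibits
      \<open>B $$ (0,Suc 0)\<close> as the additive quotient.\<close>
    note entry = mult_mat_entry_2[OF affine_mat_entries(1) Bc, of _ _ 1 y,
        folded eq[unfolded upper_triangular_monoid_simps(2)]]
    have "x = B $$ (0,Suc 0) + y * B $$ (Suc 0,Suc 0)" "B $$ (Suc 0,Suc 0) = 1"
      using entry[of 0 "Suc 0"] entry[of "Suc 0" "Suc 0"] by simp_all
    then show "\<exists>s\<in>carrier (additive_monoid TYPE('a)). x = y \<otimes>\<^bsub>additive_monoid TYPE('a)\<^esub> s"
      by (intro bexI[of _ "B $$ (0,Suc 0)"]) (simp_all add: additive_monoid_def add.commute)
  qed (simp add: comm_monoid.axioms additive_monoid_comm_monoid)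
  show "accp (nonzero_monoid TYPE('a))"
  proof (rule right_accp_reflect[OF _ T assms, where f = "\<lambda>a. affine_mat a 0"])
    show "(\<lambda>a. affine_mat a 0) \<in> hom (nonzero_monoid TYPE('a)) ?T"
      by (auto simp: hom_def affine_mat_closed upper_triangular_monoid_simps(2) affine_mat_mult
          nonzero_monoid_def)
  next
    fix x y :: 'a and B assume B: "B \<in> carrier ?T"
      and eq: "affine_mat x 0 = affine_mat y 0 \<otimes>\<^bsub>?T\<^esub> B"
    have Bc: "B \<in> carrier_mat 2 2" and nz: "B $$ (0,0) \<noteq> 0"
      using B by (auto simp: upper_triangular_monoid_simps)
    have "x = y * B $$ (0,0)"
      using mult_mat_entry_2[OF affine_mat_entries(1) Bc, of 0 0 y 0,
        folded eq[unfolded upper_triangular_monoid_simps(2)]] by simp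
    then show "\<exists>a\<in>carrier (nonzero_monoid TYPE('a)). x = y \<otimes>\<^bsub>nonzero_monoid TYPE('a)\<^esub> a"
      using nz by (intro bexI[of _ "B $$ (0,0)"]) (simp_all add: nonzero_monoid_def)
  qed (simp add: comm_monoid.axioms nonzero_monoid_comm_monoid)
qed

text \<open>Both operations of S are commutative, so the same two maps are homomorphisms into the
  opposite monoid as well.\<close>

lemma bi_accp_if_left_accp:
  assumes "left_accp (upper_triangular_monoid TYPE('a::information_semialgebra) 2)"
    (is "left_accp ?T")
  shows "bi_accp TYPE('a)"
  unfolding bi_accp_def
proof
  note T = monoid.monoid_opposite[OF monoid_upper_triangular[of "TYPE('a)" 2]]
  note acc = assms[unfolded left_accp_iff_opposite]
  show "accp (additive_monoid TYPE('a))"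
  proof (rule right_accp_reflect[OF _ T acc, where f = "affine_mat 1"])
    show "affine_mat 1 \<in> hom (additive_monoid TYPE('a)) (opposite_monoid ?T)"
      by (auto simp: hom_def affine_mat_closed upper_triangular_monoid_simps(2) affine_mat_mult
          additive_monoid_def)
  next
    fix x y :: 'a and B assume B: "B \<in> carrier (opposite_monoid ?T)"
      and eq: "affine_mat 1 x = affine_mat 1 y \<otimes>\<^bsub>opposite_monoid ?T\<^esub> B"
    have Bc: "B \<in> carrier_mat 2 2" using B by (simp add: upper_triangular_monoid_simps)
    note entry = mult_mat_entry_2[OF Bc affine_mat_entries(1), of _ _ 1 y,
        folded eq[unfolded opposite_monoid_simps upper_triangular_monoid_simps(2)]]
    \<comment> \<open>With \<open>B\<close> on the left, it is the upper left entry that is forced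
      to be 1.\<close>
    have "x = B $$ (0,0) * y + B $$ (0,Suc 0)" "B $$ (0,0) = 1"
      using entry[of 0 "Suc 0"] entry[of 0 0] by simp_all
    then show "\<exists>s\<in>carrier (additive_monoid TYPE('a)). x = y \<otimes>\<^bsub>additive_monoid TYPE('a)\<^esub> s"
      by (intro bexI[of _ "B $$ (0,Suc 0)"]) (simp_all add: additive_monoid_def)
  qed (simp add: comm_monoid.axioms additive_monoid_comm_monoid)
  show "accp (nonzero_monoid TYPE('a))"
  proof (rule right_accp_reflect[OF _ T acc, where f = "\<lambda>a. affine_mat a 0"])
    show "(\<lambda>a. affine_mat a 0) \<in> hom (nonzero_monoid TYPE('a)) (opposite_monoid ?T)"
      by (auto simp: hom_def affine_mat_closed upper_triangular_monoid_simps(2) affine_mat_mult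
          nonzero_monoid_def mult.commute)
  next
    fix x y :: 'a and B assume B: "B \<in> carrier (opposite_monoid ?T)"
      and eq: "affine_mat x 0 = affine_mat y 0 \<otimes>\<^bsub>opposite_monoid ?T\<^esub> B"
    have Bc: "B \<in> carrier_mat 2 2" and nz: "B $$ (0,0) \<noteq> 0"
      using B by (auto simp: upper_triangular_monoid_simps)
    have "x = B $$ (0,0) * y"
      using mult_mat_entry_2[OF Bc affine_mat_entries(1), of 0 0 y 0,
        folded eq[unfolded opposite_monoid_simps upper_triangular_monoid_simps(2)]] by simp
    then show "\<exists>a\<in>carrier (nonzero_monoid TYPE('a)). x = y \<otimes>\<^bsub>nonzero_monoid TYPE('a)\<^esub> a"
      using nz by (intro bexI[of _ "B $$ (0,0)"]) (simp_all add: nonzero_monoid_def mult.commute)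
  qed (simp add: comm_monoid.axioms nonzero_monoid_comm_monoid)
qed

theorem theorem4p7:
  assumes "reduced TYPE('a::information_semialgebra)"
  shows "(bi_accp TYPE('a) \<longleftrightarrow>
            (\<forall>n\<ge>1. right_accp (upper_triangular_monoid TYPE('a) n))) \<and>
         (bi_accp TYPE('a) \<longleftrightarrow>
            (\<forall>n\<ge>1. left_accp (upper_triangular_monoid TYPE('a) n)))"
proof (intro conjI iffI allI impI)
  assume "bi_accp TYPE('a)"
  then show "right_accp (upper_triangular_monoid TYPE('a) n)"
    and "left_accp (upper_triangular_monoid TYPE('a) n)" for n
    by (rule right_accp_upper_triangular[OF assms] left_accp_upper_triangular[OF assms])+
next
  assume "\<forall>n\<ge>1. right_accp (upper_triangular_monoid TYPE('a) n)"
  \<comment> \<open>The assumption is applied at \<open>n = 2\<close>, the smallest size with an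
    off-diagonal entry to carry addition.\<close>
  then show "bi_accp TYPE('a)" by (intro bi_accp_if_right_accp) simp
next
  assume "\<forall>n\<ge>1. left_accp (upper_triangular_monoid TYPE('a) n)"
  then show "bi_accp TYPE('a)" by (intro bi_accp_if_left_accp) simp
qed

end
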